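(* If $\chi_I\vdash c:\chi_O$, then for every partial structure ${\cal L}$ and every substitution $\sigma$ with $\mathrm{dom}(\sigma)\supseteq\chi_I$, $\widehat{{\tt sat}}({\cal L},c\sigma)$ is defined, and for each $\sigma'\in\widehat{{\tt sat}}({\cal L},c\sigma)$ we have $\chi_I\cup\mathrm{dom}(\sigma')\supseteq\chi_O$.
   Context: Restrictions: $c ::= p_O(t_1,\ldots,t_n)\mid\vec x\not\in S\mid\top\mid\bot\mid c_1\wedge c_2\mid c_1\vee c_2\mid\exists x.c$, where $p_O$ ranges over objective predicates and $\vec x\not\in S$ is a special objective atom ($S$ a finite set of tuples of ground terms). A partial structure ${\cal L}$ is a total function $\rho_{\cal L}$ from ground atoms to $\{{\tt tt},{\tt ff},{\tt uu}\}$; ${\cal L}\models P$ iff $\rho_{\cal L}(P)={\tt tt}$, and $\rho_{\cal L}(\vec t\not\in S)={\tt tt}$ iff $\vec t\notin S$. Substitutions map finitely many variables to ground terms; $\bullet$ is the empty substitution; $\sigma'\geq\sigma$ means $\sigma'$ extends $\sigma$; $\sigma_1+\sigma_2$ is union; $\sigma\backslash\{x\}$ removes $x$ from the domain. Each objective predicate $p_O$ has input positions $I(p_O)$ and output positions $O(p_O)$ (all positions of $\vec x\not\in S$ are input). A function ${\tt sat}$ is given: for each ${\cal L}$ and objective atom $P=p_O(t_1,\ldots,t_n)$ with $t_k$ ground for all $k\in I(p_O)$, ${\tt sat}({\cal L},P)$ is a finite set of substitutions, each with domain containing $\bigcup_{j\in O(p_O)}\mathrm{fv}(t_j)$, such that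 for every $\sigma'$ with $\mathrm{dom}(\sigma')\supseteq\mathrm{fv}(P)$, ${\cal L}\models P\sigma'$ iff $\sigma'\geq\sigma$ for some $\sigma\in{\tt sat}({\cal L},P)$; it is undefined when some input argument is not ground. (For ground $\vec t$: ${\tt sat}({\cal L},\vec t\not\in S)=\{\bullet\}$ if $\vec t\notin S$, else $\{\}$.) $\widehat{{\tt sat}}$: $\widehat{{\tt sat}}({\cal L},p_O(\vec t))={\tt sat}({\cal L},p_O(\vec t))$; $\widehat{{\tt sat}}({\cal L},\top)=\{\bullet\}$; $\widehat{{\tt sat}}({\cal L},\bot)=\{\}$; $\widehat{{\tt sat}}({\cal L},c_1\wedge c_2)=\bigcup_{\sigma_1\in\widehat{{\tt sat}}({\cal L},c_1)}\{\sigma_1+\sigma_2:\sigma_2\in\widehat{{\tt sat}}({\cal L},c_2\sigma_1)\}$; $\widehat{{\tt sat}}({\cal L},c_1\vee c_2)=\widehat{{\tt sat}}({\cal L},c_1)\cup\widehat{{\tt sat}}({\cal L},c_2)$; $\widehat{{\tt sat}}({\cal L},\exists x.c)=\{\sigma\backslash\{x\}:\sigma\in\widehat{{\tt sat}}({\cal L},c)\}$; defined only when all constituent calls are defined. Mode judgment $\chi_I\vdash c:\chi_O$ ($\chi_I,\chi_O$ sets of variables), defined inductively: $\chi_I\vdash p_O(t_1,\ldots,t_n):\chi_I\cup\bigcup_{j\in O(p_O)}\mathrm{fv}(t_j)$ provided $\mathrm{fv}(t_k)\subseteq\chi_I$ for all $k\in I(p_O)$ (in particular $\chi_I\vdash\vec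 x\not\in S:\chi_I$ if $\vec x\subseteq\chi_I$); $\chi_I\vdash\top:\chi_I$; $\chi_I\vdash\bot:\chi_I$; if $\chi_I\vdash c_1:\chi$ and $\chi\vdash c_2:\chi_O$ then $\chi_I\vdash c_1\wedge c_2:\chi_O$; if $\chi_I\vdash c_1:\chi_1$ and $\chi_I\vdash c_2:\chi_2$ then $\chi_I\vdash c_1\vee c_2:\chi_1\cap\chi_2$; if $\chi_I\vdash c:\chi_O$ then $\chi_I\vdash\exists x.c:\chi_O\backslash\{x\}$.
   Formalization: As stated the containment fails if σ binds a variable of χ_O outside χ_I. Proved: χ_O ⊆ dom(σ) ∪ dom(σ') always, and χ_O ⊆ χ_I ∪ dom(σ') when χ_O ∩ dom(σ) ⊆ χ_I. The ∃x rule requires x ∉ χ_I (bound variables renamed apart). *)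

theory Defs
  imports "HOL-Library.Finite_Map"
begin

section \<open>Terms, atoms and restrictions\<close>

datatype (fv_term: 'v, 'f) trm = Var 'v | Fun 'f "('v, 'f) trm list"

datatype 'f gterm = GFun 'f "'f gterm list"

primrec of_gterm :: "'f gterm \<Rightarrow> ('v, 'f) trm" where
  "of_gterm (GFun f ts) = Fun f (map of_gterm ts)"

text \<open>Argument positions are counted from 0.  The predicate symbols comprise the objective ones and
  all others; restrictions only use the former, but structures interpret both.\<close>

record 'p signature =
  objective :: "'p set"
  arity :: "'p \<Rightarrow> nat"
  inputs :: "'p \<Rightarrow> nat set"
  outputs :: "'p \<Rightarrow> nat set"

definition wf_signature :: "'p signature \<Rightarrow> bool" where
  "wf_signature \<Sigma> \<longleftrightarrow>
     (\<forall>p \<in> objective \<Sigma>. inputs \<Sigma> p \<subseteq> {..<arity \<Sigma> p} \<and> outputs \<Sigma> p \<subseteq> {..<arity \<Sigma> p})"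

datatype ('p, 'v, 'f) obj_atom =
    Pred 'p "('v, 'f) trm list"
  | NotIn "('v, 'f) trm list" "'f gterm list fset"

datatype ('p, 'v, 'f) restr =
    Atom "('p, 'v, 'f) obj_atom"
  | Top
  | Bot
  | Conj "('p, 'v, 'f) restr" "('p, 'v, 'f) restr"
  | Disj "('p, 'v, 'f) restr" "('p, 'v, 'f) restr"
  | Exists 'v "('p, 'v, 'f) restr"

fun wf_atom :: "'p signature \<Rightarrow> ('p, 'v, 'f) obj_atom \<Rightarrow> bool" where
  "wf_atom \<Sigma> (Pred p ts) \<longleftrightarrow> p \<in> objective \<Sigma> \<and> length ts = arity \<Sigma> p"
| "wf_atom \<Sigma> (NotIn ts S) \<longleftrightarrow> True"

primrec wf_restr :: "'p signature \<Rightarrow> ('p, 'v, 'f) restr \<Rightarrow> bool" where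
  "wf_restr \<Sigma> (Atom P) \<longleftrightarrow> wf_atom \<Sigma> P"
| "wf_restr \<Sigma> Top \<longleftrightarrow> True"
| "wf_restr \<Sigma> Bot \<longleftrightarrow> True"
| "wf_restr \<Sigma> (Conj c1 c2) \<longleftrightarrow> wf_restr \<Sigma> c1 \<and> wf_restr \<Sigma> c2"
| "wf_restr \<Sigma> (Disj c1 c2) \<longleftrightarrow> wf_restr \<Sigma> c1 \<and> wf_restr \<Sigma> c2"
| "wf_restr \<Sigma> (Exists x c) \<longleftrightarrow> wf_restr \<Sigma> c"

fun atom_args :: "('p, 'v, 'f) obj_atom \<Rightarrow> ('v, 'f) trm list" where
  "atom_args (Pred p ts) = ts"
| "atom_args (NotIn ts S) = ts"

fun in_pos :: "'p signature \<Rightarrow> ('p, 'v, 'f) obj_atom \<Rightarrow> nat set" where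
  "in_pos \<Sigma> (Pred p ts) = inputs \<Sigma> p"
| "in_pos \<Sigma> (NotIn ts S) = {..<length ts}"

fun out_pos :: "'p signature \<Rightarrow> ('p, 'v, 'f) obj_atom \<Rightarrow> nat set" where
  "out_pos \<Sigma> (Pred p ts) = outputs \<Sigma> p"
| "out_pos \<Sigma> (NotIn ts S) = {}"

definition fv_atom :: "('p, 'v, 'f) obj_atom \<Rightarrow> 'v set" where
  "fv_atom P = (\<Union>t \<in> set (atom_args P). fv_term t)"

definition out_vars :: "'p signature \<Rightarrow> ('p, 'v, 'f) obj_atom \<Rightarrow> 'v set" where
  "out_vars \<Sigma> P = (\<Union>j \<in> out_pos \<Sigma> P. fv_term (atom_args P ! j))"

section \<open>Substitutions\<close>

text \<open>Finite maps from variables to ground terms.  Domain, extension and \<open>\<sigma>\<setminus>{x}\<close> are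
  \<^const>\<open>fmdom'\<close>, \<^const>\<open>fmsubset\<close> and \<^const>\<open>fmdrop\<close>.\<close>

type_synonym ('v, 'f) subst = "('v, 'f gterm) fmap"

primrec subst_term :: "('v, 'f) subst \<Rightarrow> ('v, 'f) trm \<Rightarrow> ('v, 'f) trm" where
  "subst_term \<sigma> (Var x) = (case fmlookup \<sigma> x of None \<Rightarrow> Var x | Some g \<Rightarrow> of_gterm g)"
| "subst_term \<sigma> (Fun f ts) = Fun f (map (subst_term \<sigma>) ts)"

primrec subst_atom :: "('v, 'f) subst \<Rightarrow> ('p, 'v, 'f) obj_atom \<Rightarrow> ('p, 'v, 'f) obj_atom" where
  "subst_atom \<sigma> (Pred p ts) = Pred p (map (subst_term \<sigma>) ts)"
| "subst_atom \<sigma> (NotIn ts S) = NotIn (map (subst_term \<sigma>) ts) S"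

text \<open>Since substitutions have ground range, capture cannot occur; it suffices to leave the bound
  variable alone.\<close>

primrec subst_restr :: "('v, 'f) subst \<Rightarrow> ('p, 'v, 'f) restr \<Rightarrow> ('p, 'v, 'f) restr" where
  "subst_restr \<sigma> (Atom P) = Atom (subst_atom \<sigma> P)"
| "subst_restr \<sigma> Top = Top"
| "subst_restr \<sigma> Bot = Bot"
| "subst_restr \<sigma> (Conj c1 c2) = Conj (subst_restr \<sigma> c1) (subst_restr \<sigma> c2)"
| "subst_restr \<sigma> (Disj c1 c2) = Disj (subst_restr \<sigma> c1) (subst_restr \<sigma> c2)"
| "subst_restr \<sigma> (Exists x c) = Exists x (subst_restr (fmdrop x \<sigma>) c)"

text \<open>Substitution may enlarge terms but not this measure.\<close>

primrec restr_size :: "('p, 'v, 'f) restr \<Rightarrow> nat" where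
  "restr_size (Atom P) = 0"
| "restr_size Top = 0"
| "restr_size Bot = 0"
| "restr_size (Conj c1 c2) = Suc (restr_size c1 + restr_size c2)"
| "restr_size (Disj c1 c2) = Suc (restr_size c1 + restr_size c2)"
| "restr_size (Exists x c) = Suc (restr_size c)"

lemma restr_size_subst [simp]: "restr_size (subst_restr \<sigma> c) = restr_size c"
  by (induction c arbitrary: \<sigma>) auto

section \<open>Partial structures\<close>

datatype truth = TT | FF | UU

type_synonym ('p, 'f) pstruct = "'p \<Rightarrow> 'f gterm list \<Rightarrow> truth"

text \<open>Satisfaction of an objective atom; it is false for atoms that are not ground.  The special
  atoms have the same fixed meaning in all structures.\<close>

primrec sat_atom :: "('p, 'f) pstruct \<Rightarrow> ('p, 'v, 'f) obj_atom \<Rightarrow> bool" where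
  "sat_atom L (Pred p ts) \<longleftrightarrow> (\<exists>gs. ts = map of_gterm gs \<and> L p gs = TT)"
| "sat_atom L (NotIn ts S) \<longleftrightarrow> (\<exists>gs. ts = map of_gterm gs \<and> gs |\<notin>| S)"

section \<open>The functions \<open>sat\<close> and \<open>sat_hat\<close>\<close>

text \<open>Partiality is rendered by the option type: undefined calls return \<^const>\<open>None\<close>.\<close>

type_synonym ('p, 'v, 'f) sat_fun =
  "('p, 'f) pstruct \<Rightarrow> ('p, 'v, 'f) obj_atom \<Rightarrow> ('v, 'f) subst set option"

text \<open>The specification is stated for a single structure.  It is not satisfiable for every structure:
  if infinitely many ground instances of an atom with non-ground output hold in \<open>L\<close>, no finite set of
  substitutions describes them.  Hence it can only be assumed for a suitable class of structures.\<close>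

definition sat_spec :: "'p signature \<Rightarrow> ('p, 'v, 'f) sat_fun \<Rightarrow> ('p, 'f) pstruct \<Rightarrow> bool" where
  "sat_spec \<Sigma> sat L \<longleftrightarrow>
     (\<forall>P. wf_atom \<Sigma> P \<longrightarrow>
        (sat L P \<noteq> None \<longleftrightarrow> (\<forall>k \<in> in_pos \<Sigma> P. fv_term (atom_args P ! k) = {})) \<and>
        (\<forall>\<Theta>. sat L P = Some \<Theta> \<longrightarrow>
           finite \<Theta> \<and>
           (\<forall>\<sigma> \<in> \<Theta>. out_vars \<Sigma> P \<subseteq> fmdom' \<sigma>) \<and>
           (\<forall>\<sigma>'. fv_atom P \<subseteq> fmdom' \<sigma>' \<longrightarrow>
              (sat_atom L (subst_atom \<sigma>' P) \<longleftrightarrow> (\<exists>\<sigma> \<in> \<Theta>. \<sigma> \<subseteq>\<^sub>f \<sigma>'))))) \<and>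
     (\<forall>gs S. sat L (NotIn (map of_gterm gs) S) = Some (if gs |\<notin>| S then {fmempty} else {}))"

text \<open>The union of substitutions is \<^const>\<open>fmadd\<close>.  In the case of \<^const>\<open>Conj\<close>, \<open>\<sigma>1\<close> has already been
  applied to \<open>c2\<close>, so the two domains overlap only if \<open>sat\<close> binds variables that do not occur in the
  atom; the bias of \<^const>\<open>fmadd\<close> matters only then.\<close>

function sat_hat ::
  "('p, 'v, 'f) sat_fun \<Rightarrow> ('p, 'f) pstruct \<Rightarrow> ('p, 'v, 'f) restr \<Rightarrow> ('v, 'f) subst set option"
where
  "sat_hat sat L (Atom P) = sat L P"
| "sat_hat sat L Top = Some {fmempty}"
| "sat_hat sat L Bot = Some {}"
| "sat_hat sat L (Conj c1 c2) =
     (case sat_hat sat L c1 of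
        None \<Rightarrow> None
      | Some \<Theta>1 \<Rightarrow>
          if \<forall>\<sigma>1 \<in> \<Theta>1. sat_hat sat L (subst_restr \<sigma>1 c2) \<noteq> None
          then Some (\<Union>\<sigma>1 \<in> \<Theta>1. {\<sigma>1 ++\<^sub>f \<sigma>2 |\<sigma>2. \<sigma>2 \<in> the (sat_hat sat L (subst_restr \<sigma>1 c2))})
          else None)"
| "sat_hat sat L (Disj c1 c2) =
     (case (sat_hat sat L c1, sat_hat sat L c2) of
        (Some \<Theta>1, Some \<Theta>2) \<Rightarrow> Some (\<Theta>1 \<union> \<Theta>2)
      | _ \<Rightarrow> None)"
| "sat_hat sat L (Exists x c) = map_option (\<lambda>\<Theta>. {fmdrop x \<sigma> |\<sigma>. \<sigma> \<in> \<Theta>}) (sat_hat sat L c)"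
  by pat_completeness auto
termination
  by (relation "measure (\<lambda>(_, _, c). restr_size c)") auto

section \<open>The mode judgment\<close>

text \<open>The side condition in the rule for \<^const>\<open>Exists\<close> is the convention that bound variables are
  renamed apart from the variables in scope.  On raw syntax it has to be explicit: a bound \<open>x\<close> must
  not count as ground because a different, free \<open>x\<close> belongs to \<open>\<chi>\<close>.  For instance, without it
  \<open>\<exists>x. p(x)\<close> with input \<open>x\<close> would be well-moded for \<open>\<chi> = {x}\<close>, although \<open>sat\<close> is undefined
  on \<open>p(x)\<close>.\<close>

inductive mode :: "'p signature \<Rightarrow> 'v set \<Rightarrow> ('p, 'v, 'f) restr \<Rightarrow> 'v set \<Rightarrow> bool"
  for \<Sigma> :: "'p signature"
where
  mode_Atom: "(\<And>k. k \<in> in_pos \<Sigma> P \<Longrightarrow> fv_term (atom_args P ! k) \<subseteq> \<chi>) \<Longrightarrow>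
     mode \<Sigma> \<chi> (Atom P) (\<chi> \<union> out_vars \<Sigma> P)"
| mode_Top: "mode \<Sigma> \<chi> Top \<chi>"
| mode_Bot: "mode \<Sigma> \<chi> Bot \<chi>"
| mode_Conj: "mode \<Sigma> \<chi> c1 \<chi>1 \<Longrightarrow> mode \<Sigma> \<chi>1 c2 \<chi>2 \<Longrightarrow> mode \<Sigma> \<chi> (Conj c1 c2) \<chi>2"
| mode_Disj: "mode \<Sigma> \<chi> c1 \<chi>1 \<Longrightarrow> mode \<Sigma> \<chi> c2 \<chi>2 \<Longrightarrow> mode \<Sigma> \<chi> (Disj c1 c2) (\<chi>1 \<inter> \<chi>2)"
| mode_Exists: "mode \<Sigma> \<chi> c \<chi>' \<Longrightarrow> x \<notin> \<chi> \<Longrightarrow> mode \<Sigma> \<chi> (Exists x c) (\<chi>' - {x})"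

end

theory Submission
  imports Defs
begin

text \<open>The mode judgment tracks which variables are known ground, so the proof is an induction
  on its derivation, for all substitutions covering the input variables
  (\<open>sat_hat_mode\<close>). The invariant is that the domain of the applied
  \<open>\<sigma>\<close> and that of any answer jointly cover the output variables. For an atom,
  \<open>\<sigma>\<close> grounds the input arguments, so \<open>sat\<close> is defined, and answers
  bind the outputs that \<open>\<sigma>\<close> left open (\<open>sat_subst_atom\<close>). In a
  conjunction, applying \<open>\<sigma>\<close> and then an answer of the first conjunct amounts to
  one substitution (\<open>subst_restr_subst_restr\<close>), to which the hypothesis for the second
  conjunct applies. An answer to a disjunction comes from one branch, so it covers at least the
  intersection.\<close>

lemma fv_of_gterm [simp]: "fv_term (of_gterm g) = {}"
  by (induction g) auto

lemma subst_of_gterm [simp]: "subst_term \<sigma> (of_gterm g) = of_gterm g"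
  by (induction g) auto

lemma fv_subst_term: "fv_term (subst_term \<sigma> t) = fv_term t - fmdom' \<sigma>"
  by (induction t) (auto simp: fmdom'I fmlookup_dom'_iff split: option.splits)

text \<open>A variable bound by \<open>\<sigma>\<close> is already ground when \<open>\<tau>\<close>
  arrives, so \<open>\<sigma>\<close> must win; \<open>++\<^sub>f\<close> favours its right
  argument.\<close>

lemma subst_term_subst_term:
  "subst_term \<tau> (subst_term \<sigma> t) = subst_term (\<tau> ++\<^sub>f \<sigma>) t"
  by (induction t) (auto simp: fmlookup_dom_iff split: option.splits)

lemma subst_atom_subst_atom:
  "subst_atom \<tau> (subst_atom \<sigma> P) = subst_atom (\<tau> ++\<^sub>f \<sigma>) P"
  by (cases P) (auto simp: subst_term_subst_term)

lemma subst_restr_subst_restr: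
  "subst_restr \<tau> (subst_restr \<sigma> c) = subst_restr (\<tau> ++\<^sub>f \<sigma>) c"
  by (induction c arbitrary: \<sigma> \<tau>) (auto simp: subst_atom_subst_atom)

lemma atom_args_subst_atom [simp]:
  "atom_args (subst_atom \<sigma> P) = map (subst_term \<sigma>) (atom_args P)"
  by (cases P) auto

lemma in_pos_subst_atom [simp]: "in_pos \<Sigma> (subst_atom \<sigma> P) = in_pos \<Sigma> P"
  by (cases P) auto

lemma out_pos_subst_atom [simp]: "out_pos \<Sigma> (subst_atom \<sigma> P) = out_pos \<Sigma> P"
  by (cases P) auto

lemma wf_atom_subst_atom [simp]: "wf_atom \<Sigma> (subst_atom \<sigma> P) = wf_atom \<Sigma> P"
  by (cases P) auto

text \<open>Indexing into \<open>map (subst_term \<sigma>) ts\<close> can be pushed through the map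
  only at valid positions.\<close>

lemma in_pos_less_length:
  assumes "wf_signature \<Sigma>" "wf_atom \<Sigma> P" "k \<in> in_pos \<Sigma> P"
  shows "k < length (atom_args P)"
  using assms by (cases P) (auto simp: wf_signature_def)

lemma out_pos_less_length:
  assumes "wf_signature \<Sigma>" "wf_atom \<Sigma> P" "k \<in> out_pos \<Sigma> P"
  shows "k < length (atom_args P)"
  using assms by (cases P) (auto simp: wf_signature_def)

lemma out_vars_subst_atom:
  assumes "wf_signature \<Sigma>" "wf_atom \<Sigma> P"
  shows "out_vars \<Sigma> (subst_atom \<sigma> P) = out_vars \<Sigma> P - fmdom' \<sigma>"
  using out_pos_less_length[OF assms] by (auto simp: out_vars_def fv_subst_term)

lemma sat_subst_atom:
  assumes wf: "wf_signature \<Sigma>" "wf_atom \<Sigma> P" and spec: "sat_spec \<Sigma> sat L"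
    and ins: "\<And>k. k \<in> in_pos \<Sigma> P \<Longrightarrow> fv_term (atom_args P ! k) \<subseteq> fmdom' \<sigma>"
  obtains \<Theta> where "sat L (subst_atom \<sigma> P) = Some \<Theta>"
    and "\<And>\<sigma>'. \<sigma>' \<in> \<Theta> \<Longrightarrow> out_vars \<Sigma> P \<subseteq> fmdom' \<sigma> \<union> fmdom' \<sigma>'"
proof -
  have spec': "(sat L P' \<noteq> None \<longleftrightarrow> (\<forall>k \<in> in_pos \<Sigma> P'. fv_term (atom_args P' ! k) = {})) \<and>
      (\<forall>\<Theta>. sat L P' = Some \<Theta> \<longrightarrow> (\<forall>\<sigma>' \<in> \<Theta>. out_vars \<Sigma> P' \<subseteq> fmdom' \<sigma>'))"
    if "wf_atom \<Sigma> P'" for P'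
    using spec that unfolding sat_spec_def by blast
  have "\<forall>k \<in> in_pos \<Sigma> (subst_atom \<sigma> P). fv_term (atom_args (subst_atom \<sigma> P) ! k) = {}"
    using ins in_pos_less_length[OF wf] by (auto simp: fv_subst_term)
  with spec'[of "subst_atom \<sigma> P"] wf obtain \<Theta> where "sat L (subst_atom \<sigma> P) = Some \<Theta>"
    and "\<forall>\<sigma>' \<in> \<Theta>. out_vars \<Sigma> (subst_atom \<sigma> P) \<subseteq> fmdom' \<sigma>'"
    by auto
  with that show thesis
    by (auto simp: out_vars_subst_atom[OF wf])
qed

lemma sat_hat_mode:
  assumes "mode \<Sigma> \<chi> c \<chi>'" "wf_signature \<Sigma>" "sat_spec \<Sigma> sat L" "wf_restr \<Sigma> c"
    and "\<chi> \<subseteq> fmdom' \<sigma>"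
  shows "\<exists>\<Theta>. sat_hat sat L (subst_restr \<sigma> c) = Some \<Theta> \<and>
    (\<forall>\<sigma>' \<in> \<Theta>. \<chi>' \<subseteq> fmdom' \<sigma> \<union> fmdom' \<sigma>')"
  using assms
proof (induction arbitrary: \<sigma> rule: mode.induct)
  case (mode_Atom P \<chi>)
  have "wf_atom \<Sigma> P" "\<And>k. k \<in> in_pos \<Sigma> P \<Longrightarrow> fv_term (atom_args P ! k) \<subseteq> fmdom' \<sigma>"
    using mode_Atom by auto
  from sat_subst_atom[OF \<open>wf_signature \<Sigma>\<close> this(1) \<open>sat_spec \<Sigma> sat L\<close> this(2)]
  obtain \<Theta> where "sat L (subst_atom \<sigma> P) = Some \<Theta>"
    "\<And>\<sigma>'. \<sigma>' \<in> \<Theta> \<Longrightarrow> out_vars \<Sigma> P \<subseteq> fmdom' \<sigma> \<union> fmdom' \<sigma>'"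
    by blast
  with mode_Atom.prems show ?case by auto
next
  case (mode_Conj \<chi> c1 \<chi>1 c2 \<chi>2)
  from mode_Conj.IH(1)[of \<sigma>] mode_Conj.prems obtain \<Theta>1
    where \<Theta>1: "sat_hat sat L (subst_restr \<sigma> c1) = Some \<Theta>1"
      and dom1: "\<And>\<sigma>1. \<sigma>1 \<in> \<Theta>1 \<Longrightarrow> \<chi>1 \<subseteq> fmdom' \<sigma> \<union> fmdom' \<sigma>1"
    by auto
  have "\<exists>\<Theta>2. sat_hat sat L (subst_restr \<sigma>1 (subst_restr \<sigma> c2)) = Some \<Theta>2 \<and>
      (\<forall>\<sigma>2 \<in> \<Theta>2. \<chi>2 \<subseteq> fmdom' \<sigma> \<union> fmdom' \<sigma>1 \<union> fmdom' \<sigma>2)" if "\<sigma>1 \<in> \<Theta>1" for \<sigma>1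
    \<comment> \<open>By \<open>dom1\<close>, the combined substitution covers
      \<open>\<chi>1\<close>, the input set of \<open>c2\<close>.\<close>
    using mode_Conj.IH(2)[of "\<sigma>1 ++\<^sub>f \<sigma>"] mode_Conj.prems dom1[OF that]
    by (simp add: subst_restr_subst_restr Un_ac)
  then show ?case
    by (fastforce simp: \<Theta>1)
next
  case (mode_Disj \<chi> c1 \<chi>1 c2 \<chi>2)
  from mode_Disj.IH(1)[of \<sigma>] mode_Disj.IH(2)[of \<sigma>] mode_Disj.prems show ?case
    by fastforce
next
  case (mode_Exists \<chi> c \<chi>' x)
  \<comment> \<open>Under the binder only \<open>fmdrop x \<sigma>\<close> is applied; it still
    covers \<open>\<chi>\<close> because the mode rule requires \<open>x\<close> to lie outside
    \<open>\<chi>\<close>.\<close>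
  have "\<chi> \<subseteq> fmdom' (fmdrop x \<sigma>)"
    using mode_Exists by auto
  with mode_Exists.IH[of "fmdrop x \<sigma>"] mode_Exists.prems show ?case
    by fastforce
qed auto

text \<open>The inclusion in \<open>\<chi>I \<union> fmdom' \<sigma>'\<close> is conditional because
  \<open>\<sigma>\<close> may itself bind an output variable outside \<open>\<chi>I\<close>; that
  variable is then gone from the instance and an answer need not bind it. When
  \<open>\<sigma>\<close> binds no such variable, the inclusion follows from the joint one.\<close>

theorem mainTheorem6:
  fixes \<Sigma> :: "'p signature"
    and Ls :: "('p, 'f) pstruct set"
    and sat :: "('p, 'v, 'f) sat_fun"
    and c :: "('p, 'v, 'f) restr"
    and \<chi>I \<chi>O :: "'v set"
  assumes "wf_signature \<Sigma>"
    and "\<forall>L \<in> Ls. sat_spec \<Sigma> sat L"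
    and "wf_restr \<Sigma> c"
    and "mode \<Sigma> \<chi>I c \<chi>O"
  shows "\<forall>L \<in> Ls. \<forall>\<sigma> :: ('v, 'f) subst. \<chi>I \<subseteq> fmdom' \<sigma> \<longrightarrow>
    (\<exists>\<Theta>. sat_hat sat L (subst_restr \<sigma> c) = Some \<Theta> \<and>
      (\<forall>\<sigma>' \<in> \<Theta>.
         \<chi>O \<subseteq> fmdom' \<sigma> \<union> fmdom' \<sigma>' \<and>
         (\<chi>O \<inter> fmdom' \<sigma> \<subseteq> \<chi>I \<longrightarrow> \<chi>O \<subseteq> \<chi>I \<union> fmdom' \<sigma>')))"
proof (intro ballI allI impI)
  fix L and \<sigma> :: "('v, 'f) subst"
  assume "L \<in> Ls" "\<chi>I \<subseteq> fmdom' \<sigma>"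
  with sat_hat_mode[OF assms(4,1) _ assms(3)] assms(2)
  obtain \<Theta> where "sat_hat sat L (subst_restr \<sigma> c) = Some \<Theta>"
    "\<forall>\<sigma>' \<in> \<Theta>. \<chi>O \<subseteq> fmdom' \<sigma> \<union> fmdom' \<sigma>'"
    by meson
  then show "\<exists>\<Theta>. sat_hat sat L (subst_restr \<sigma> c) = Some \<Theta> \<and>
      (\<forall>\<sigma>' \<in> \<Theta>.
         \<chi>O \<subseteq> fmdom' \<sigma> \<union> fmdom' \<sigma>' \<and>
         (\<chi>O \<inter> fmdom' \<sigma> \<subseteq> \<chi>I \<longrightarrow> \<chi>O \<subseteq> \<chi>I \<union> fmdom' \<sigma>'))"
    by blast
qed

end
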